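(* Let $n\ge 2$ and let $A=[a_{ij}]\in\mathbb{M}(n)$ be a normal matrix with eigenvalues $\lambda_1(A),\dots,\lambda_n(A)$ (counted with multiplicity). Then $$\mathrm{spd}(A)\ge\max_{1\le i,j\le n}\left|\lambda_i(A)-\frac{1}{n-1}\sum_{k=1,\,k\ne j}^{n}\lambda_k(A)\right|\ge\frac{1}{n-1}\left|\sum_{i\ne j}a_{ij}\right|.$$
   Context: $\mathbb{M}(n)$ is the algebra of all $n\times n$ complex matrices. The spread of $A\in\mathbb{M}(n)$ with eigenvalues $\lambda_1(A),\dots,\lambda_n(A)$ is $\mathrm{spd}(A)=\max_{1\le i,j\le n}|\lambda_i(A)-\lambda_j(A)|$. The sum $\sum_{i\neq j}a_{ij}$ is over all ordered pairs $(i,j)$ of distinct indices in $\{1,\dots,n\}$. *)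

theory Defs
  imports "Jordan_Normal_Form.Spectral_Radius" "Jordan_Normal_Form.Schur_Decomposition"
begin

definition normal_mat :: "complex mat \<Rightarrow> bool" where
  "normal_mat A \<longleftrightarrow> A * mat_adjoint A = mat_adjoint A * A"

text \<open>The spread does not see multiplicities, so the maximum is taken over the set of eigenvalues;
  \<open>spd_eq_Max_index\<close> gives the form over an indexed family of eigenvalues. It is meant only for
  square matrices of positive dimension, for which the set below is finite and nonempty.\<close>

definition spd :: "complex mat \<Rightarrow> real" where
  "spd A = Max {cmod (x - y) | x y. x \<in> spectrum A \<and> y \<in> spectrum A}"

lemma spectrum_eq_image:
  fixes A :: "complex mat" and l :: "nat \<Rightarrow> complex"
  assumes "A \<in> carrier_mat n n" and "char_poly A = (\<Prod>i<n. [:- l i, 1:])"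
  shows "spectrum A = l ` {..<n}"
  using eigenvalue_root_char_poly[OF assms(1)]
  by (auto simp: spectrum_def assms(2) poly_prod)

lemma spd_eq_Max_index:
  fixes A :: "complex mat" and l :: "nat \<Rightarrow> complex"
  assumes "A \<in> carrier_mat n n" and "char_poly A = (\<Prod>i<n. [:- l i, 1:])"
  shows "spd A = (MAX (i, j) \<in> {..<n} \<times> {..<n}. cmod (l i - l j))"
  unfolding spd_def spectrum_eq_image[OF assms]
  by (rule arg_cong[where f = Max]) auto

end

theory Submission
  imports Defs
begin

text \<open>Let \<open>e\<close> be the all-ones vector. Since \<open>A\<close> is normal it has an orthogonal eigenbasis, so
  \<open>\<langle>A e, e\<rangle> = \<Sum>k. w k * l k\<close> with weights \<open>w k \<ge> 0\<close> of total \<open>\<langle>e, e\<rangle> = n\<close>. The off-diagonal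
  sum is \<open>\<langle>A e, e\<rangle> - tr A\<close>, and dividing it by \<open>n - 1\<close> gives the convex combination, with weights
  \<open>w k / n\<close>, of the numbers \<open>l k - (tr A - l k) / (n - 1)\<close>: already the terms with \<open>i = j\<close> of
  the maximum suffice. The bound by the spread holds because each term is an average of
  differences of eigenvalues.

  The eigenbasis comes from the triangularization \<open>A = P T P\<^sup>-\<^sup>1\<close>, in which \<open>P\<close> need not
  be unitary: for normal \<open>A\<close>, the Gram--Schmidt orthogonalization of the columns of \<open>P\<close> consists
  of eigenvectors.\<close>

text \<open>A vector of dimension \<open>n\<close> is a function on \<open>nat\<close> of which only the values below \<open>n\<close>
  matter.\<close>

definition cinner :: "nat \<Rightarrow> (nat \<Rightarrow> complex) \<Rightarrow> (nat \<Rightarrow> complex) \<Rightarrow> complex" where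
  "cinner n x y = (\<Sum>r<n. x r * cnj (y r))"

definition mapply :: "nat \<Rightarrow> (nat \<Rightarrow> nat \<Rightarrow> complex) \<Rightarrow> (nat \<Rightarrow> complex) \<Rightarrow> nat \<Rightarrow> complex" where
  "mapply n a x = (\<lambda>i. \<Sum>j<n. a i j * x j)"

definition adj :: "(nat \<Rightarrow> nat \<Rightarrow> complex) \<Rightarrow> nat \<Rightarrow> nat \<Rightarrow> complex" where
  "adj a = (\<lambda>i j. cnj (a j i))"

section \<open>Algebra of the inner product and of the matrix action\<close>

lemma cinner_cong:
  "(\<And>r. r < n \<Longrightarrow> x r = x' r) \<Longrightarrow> (\<And>r. r < n \<Longrightarrow> y r = y' r) \<Longrightarrow> cinner n x y = cinner n x' y'"
  by (simp add: cinner_def)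

lemma cinner_commute: "cinner n y x = cnj (cinner n x y)"
  by (simp add: cinner_def mult.commute)

lemma cinner_diff_left: "cinner n (\<lambda>r. x r - y r) z = cinner n x z - cinner n y z"
  by (simp add: cinner_def algebra_simps sum_subtractf)

lemma cinner_diff_right: "cinner n z (\<lambda>r. x r - y r) = cinner n z x - cinner n z y"
  by (simp add: cinner_def algebra_simps sum_subtractf)

lemma cinner_scale_left: "cinner n (\<lambda>r. c * x r) z = c * cinner n x z"
  by (simp add: cinner_def sum_distrib_left mult.assoc)

lemma cinner_scale_right: "cinner n z (\<lambda>r. c * x r) = cnj c * cinner n z x"
  by (simp add: cinner_def sum_distrib_left algebra_simps)

lemma cinner_sum_left: "cinner n (\<lambda>r. \<Sum>i\<in>I. f i r) z = (\<Sum>i\<in>I. cinner n (f i) z)"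
  unfolding cinner_def by (subst sum.swap) (simp add: sum_distrib_right)

lemma cinner_sum_right: "cinner n z (\<lambda>r. \<Sum>i\<in>I. f i r) = (\<Sum>i\<in>I. cinner n z (f i))"
  unfolding cinner_def by (subst sum.swap) (simp add: sum_distrib_left)

lemmas cinner_linear = cinner_diff_left cinner_diff_right cinner_scale_left cinner_scale_right
  cinner_sum_left cinner_sum_right

lemma cinner_self: "cinner n x x = of_real (\<Sum>r<n. (cmod (x r))\<^sup>2)"
  by (simp only: cinner_def of_real_sum complex_norm_square)

lemma cinner_self_eq_0D: 
  assumes "cinner n x x = 0" "r < n"
  shows "x r = 0"
proof -
  have "(\<Sum>r<n. (cmod (x r))\<^sup>2) = 0"
    using assms(1) by (simp only: cinner_self of_real_eq_0_iff)
  then show ?thesis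
    using assms(2) by (simp add: sum_nonneg_eq_0_iff)
qed

lemma cinner_self_eq_0_right: "cinner n y y = 0 \<Longrightarrow> cinner n x y = 0"
  using cinner_self_eq_0D[of n y] unfolding cinner_def[of n x y] by (intro sum.neutral) auto

lemma mapply_cong: "(\<And>r. r < n \<Longrightarrow> x r = y r) \<Longrightarrow> mapply n a x = mapply n a y"
  by (simp add: mapply_def)

lemma mapply_diff: "mapply n a (\<lambda>r. x r - y r) i = mapply n a x i - mapply n a y i"
  by (simp add: mapply_def algebra_simps sum_subtractf)

lemma mapply_sum_scale:
  "mapply n a (\<lambda>r. \<Sum>k\<in>I. c k * f k r) i = (\<Sum>k\<in>I. c k * mapply n a (f k) i)"
  unfolding mapply_def 
  by (simp add: sum_distrib_left, subst sum.swap) (simp add: algebra_simps)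

lemma cinner_mapply: "cinner n (mapply n a x) y = cinner n x (mapply n (adj a) y)"
  unfolding cinner_def mapply_def adj_def
  by (simp add: sum_distrib_left sum_distrib_right, subst sum.swap) (simp add: algebra_simps)

lemma adj_adj [simp]: "adj (adj a) = a"
  by (simp add: adj_def)

lemma mapply_mapply: "mapply n b (mapply n a x) i = (\<Sum>j<n. (\<Sum>k<n. b i k * a k j) * x j)"
  unfolding mapply_def
  by (simp add: sum_distrib_left sum_distrib_right, subst sum.swap) (simp add: algebra_simps)

section \<open>Eigenvectors of a normal matrix and of its adjoint\<close>

lemma normal_cinner_mapply:
  assumes normal: "\<And>i j. i < n \<Longrightarrow> j < n \<Longrightarrow> (\<Sum>k<n. a i k * adj a k j) = (\<Sum>k<n. adj a i k * a k j)"
  shows "cinner n (mapply n (adj a) x) (mapply n (adj a) x) = cinner n (mapply n a x) (mapply n a x)"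
proof -
  have "cinner n (mapply n (adj a) x) (mapply n (adj a) x) = cinner n x (mapply n a (mapply n (adj a) x))"
    by (simp add: cinner_mapply)
  also have "\<dots> = cinner n x (mapply n (adj a) (mapply n a x))"
    by (rule cinner_cong) (simp_all add: mapply_mapply normal)
  also have "\<dots> = cinner n (mapply n a x) (mapply n a x)"
    by (simp add: cinner_mapply)
  finally show ?thesis .
qed

text \<open>Expand the squared length of \<open>A* x - cnj l x\<close>. By normality
  \<open>A* x\<close> is as long as \<open>A x\<close>, so all four terms have modulus
  \<open>|l|^2 <x, x>\<close> and they cancel.\<close>

lemma normal_adj_eigenvector:
  assumes normal: "\<And>i j. i < n \<Longrightarrow> j < n \<Longrightarrow> (\<Sum>k<n. a i k * adj a k j) = (\<Sum>k<n. adj a i k * a k j)"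
    and eig: "\<And>r. r < n \<Longrightarrow> mapply n a x r = l * x r" and "r < n"
  shows "mapply n (adj a) x r = cnj l * x r"
proof -
  let ?y = "mapply n (adj a) x"
  \<comment> \<open>The eigenvalue equation holds only at indices below \<open>n\<close>, so it
    enters through \<open>cinner_cong\<close>.\<close>
  have ax: "cinner n (mapply n a x) z = l * cinner n x z" 
    and xa: "cinner n z (mapply n a x) = cnj l * cinner n z x" for z
    using cinner_cong[of n "mapply n a x" "\<lambda>r. l * x r" z z] 
      cinner_cong[of n z z "mapply n a x" "\<lambda>r. l * x r"] eig
    by (simp_all add: cinner_linear)
  have "cinner n ?y x = cnj l * cinner n x x"
    by (simp add: cinner_mapply xa)
  moreover have "cinner n x ?y = l * cinner n x x"
    by (simp add: cinner_mapply[symmetric] ax)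
  moreover have "cinner n ?y ?y = l * cnj l * cinner n x x"
    by (simp add: normal_cinner_mapply[OF normal] ax xa)
  ultimately have "cinner n (\<lambda>r. ?y r - cnj l * x r) (\<lambda>r. ?y r - cnj l * x r) = 0"
    by (simp add: cinner_linear)
  from cinner_self_eq_0D[OF this \<open>r < n\<close>] show ?thesis by simp
qed

section \<open>Gram-Schmidt orthogonalization without normalization\<close>

text \<open>The coefficient of a vanishing \<open>u i\<close> is \<open>0 / 0 = 0\<close>, so the family need not be linearly
  independent.\<close>

definition residual :: "nat \<Rightarrow> (nat \<Rightarrow> nat \<Rightarrow> complex) \<Rightarrow> nat \<Rightarrow> (nat \<Rightarrow> complex) \<Rightarrow> nat \<Rightarrow> complex" where
  "residual n u k x = (\<lambda>r. x r - (\<Sum>i<k. cinner n x (u i) / cinner n (u i) (u i) * u i r))"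

lemma residual_orthogonal:
  assumes orth: "\<And>i j. i < k \<Longrightarrow> j < k \<Longrightarrow> i \<noteq> j \<Longrightarrow> cinner n (u i) (u j) = 0" and "i < k"
  shows "cinner n (residual n u k x) (u i) = 0"
proof -
  have "cinner n (residual n u k x) (u i) 
    = cinner n x (u i) - (\<Sum>m<k. cinner n x (u m) / cinner n (u m) (u m) * cinner n (u m) (u i))"
    by (simp add: residual_def cinner_linear del: times_divide_eq_left)
  also have "(\<Sum>m<k. cinner n x (u m) / cinner n (u m) (u m) * cinner n (u m) (u i))
    = (\<Sum>m<k. if m = i then cinner n x (u i) / cinner n (u i) (u i) * cinner n (u i) (u i) else 0)"
    using \<open>i < k\<close> by (intro sum.cong) (auto simp: orth)
  \<comment> \<open>If \<open>u i\<close> has length 0, the left side is 0 by the convention for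
    division, and the right side is 0 because \<open>u i\<close> vanishes below
    \<open>n\<close>.\<close>
  also have "\<dots> = cinner n x (u i)"
    using \<open>i < k\<close> by (simp add: cinner_self_eq_0_right)
  finally show ?thesis by simp
qed

fun orthogonalize :: "nat \<Rightarrow> (nat \<Rightarrow> nat \<Rightarrow> complex) \<Rightarrow> nat \<Rightarrow> nat \<Rightarrow> complex" where
  "orthogonalize n v j = (\<lambda>r. v j r - 
     (\<Sum>i<j. cinner n (v j) (orthogonalize n v i) / cinner n (orthogonalize n v i) (orthogonalize n v i) * orthogonalize n v i r))"

text \<open>As a rewrite rule the recursive equation would unfold without end, since its right side
  calls \<open>orthogonalize\<close> under a bound index.\<close>

declare orthogonalize.simps [simp del]

lemma orthogonalize_eq_residual: "orthogonalize n v j = residual n (orthogonalize n v) j (v j)"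
  by (subst orthogonalize.simps) (simp add: residual_def)

text \<open>Strong induction on the larger index: once the earlier vectors are pairwise orthogonal,
  \<open>residual_orthogonal\<close> applies to the next one. Conjugate symmetry covers the other
  order.\<close>

lemma orthogonalize_orthogonal: "i \<noteq> j \<Longrightarrow> cinner n (orthogonalize n v i) (orthogonalize n v j) = 0"
proof -
  have less: "i < j \<Longrightarrow> cinner n (orthogonalize n v j) (orthogonalize n v i) = 0" for i j
  proof (induction j arbitrary: i rule: less_induct)
    case (less j)
    have "cinner n (orthogonalize n v p) (orthogonalize n v q) = 0" if "p < j" "q < j" "p \<noteq> q" for p q
      using that less.IH[of p q] less.IH[of q p] cinner_commute[of n "orthogonalize n v q" "orthogonalize n v p"]
      by (cases p q rule: linorder_cases) auto
    from residual_orthogonal[of j n "orthogonalize n v", OF this \<open>i < j\<close>] show ?case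
      by (subst orthogonalize_eq_residual)
  qed
  show "i \<noteq> j \<Longrightarrow> cinner n (orthogonalize n v i) (orthogonalize n v j) = 0"
    using less[of i j] less[of j i] cinner_commute[of n "orthogonalize n v i" "orthogonalize n v j"]
    by (cases i j rule: linorder_cases) auto
qed

text \<open>Each \<open>v m\<close> is \<open>orthogonalize n v m\<close> plus a combination of its
  predecessors. This replaces a statement about equal spans.\<close>

lemma orthogonal_orthogonalize_imp_orthogonal:
  assumes "\<And>i. i < k \<Longrightarrow> cinner n d (orthogonalize n v i) = 0" and "m < k"
  shows "cinner n d (v m) = 0"
proof -
  have "0 = cinner n d (orthogonalize n v m)" using assms by simp
  also have "\<dots> = cinner n d (v m)"
    using assms by (subst orthogonalize_eq_residual) (simp add: residual_def cinner_linear del: times_divide_eq_left)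
  finally show ?thesis by simp
qed

lemma normal_orthogonalize_eigenvector:
  assumes normal: "\<And>i j. i < n \<Longrightarrow> j < n \<Longrightarrow> (\<Sum>k<n. a i k * adj a k j) = (\<Sum>k<n. adj a i k * a k j)"
    and triangular: "\<And>j r. j < n \<Longrightarrow> r < n \<Longrightarrow> mapply n a (v j) r = l j * v j r + (\<Sum>m<j. t m j * v m r)"
    and "j < n" "r < n"
  shows "mapply n a (orthogonalize n v j) r = l j * orthogonalize n v j r"
  using \<open>j < n\<close> \<open>r < n\<close>
proof (induction j arbitrary: r rule: less_induct)
  case (less j)
  let ?u = "orthogonalize n v"
  define d where "d = (\<lambda>r. mapply n a (?u j) r - l j * ?u j r)"
  define c where "c = (\<lambda>i. cinner n (v j) (?u i) / cinner n (?u i) (?u i))"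
  have uj: "?u j r = v j r - (\<Sum>i<j. c i * ?u i r)" for r
    by (subst orthogonalize_eq_residual) (simp add: residual_def c_def)
  \<comment> \<open>Normality enters here: by induction \<open>?u i\<close> is an eigenvector, hence
    one of the adjoint too, and moving \<open>a\<close> across the inner product leaves a multiple
    of \<open>cinner n (?u j) (?u i) = 0\<close>.\<close>
  have orth: "cinner n d (?u i) = 0" if "i < j" for i
  proof -
    have "cinner n (mapply n a (?u j)) (?u i) = cinner n (?u j) (\<lambda>r. cnj (l i) * ?u i r)"
      unfolding cinner_mapply using that less normal
      by (intro cinner_cong normal_adj_eigenvector[OF normal]) auto
    then show ?thesis
      using that orthogonalize_orthogonal[of j i n v] by (simp add: d_def cinner_linear)
  qed
  \<comment> \<open>The terms \<open>l j * v j r\<close> from the triangular form and from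
    \<open>l j * ?u j r\<close> cancel, so only vectors of index below \<open>j\<close>
    remain.\<close>
  have d: "d r = (\<Sum>m<j. t m j * v m r) - (\<Sum>i<j. (c i * (l i - l j)) * ?u i r)" if "r < n" for r
  proof -
    have "mapply n a (?u j) r = mapply n a (\<lambda>r. v j r - (\<Sum>i<j. c i * ?u i r)) r"
      by (simp add: uj[abs_def])
    also have "\<dots> = mapply n a (v j) r - (\<Sum>i<j. c i * mapply n a (?u i) r)"
      by (simp only: mapply_diff mapply_sum_scale)
    also have "(\<Sum>i<j. c i * mapply n a (?u i) r) = (\<Sum>i<j. c i * (l i * ?u i r))"
      using less that by (intro sum.cong) auto
    finally show ?thesis
      using triangular[OF less.prems(1) that] unfolding d_def uj[of r]
      by (simp add: algebra_simps sum_subtractf sum_distrib_left)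
  qed
  \<comment> \<open>\<open>d\<close> lies in the span of \<open>v 0, \<dots>, v (j - 1)\<close> and is orthogonal to it.\<close>
  have "cinner n d d = cinner n d (\<lambda>r. (\<Sum>m<j. t m j * v m r) - (\<Sum>i<j. (c i * (l i - l j)) * ?u i r))"
    using d by (intro cinner_cong) auto
  also have "\<dots> = 0"
    by (simp add: cinner_linear orth orthogonal_orthogonalize_imp_orthogonal[OF orth])
  finally show ?case
    using cinner_self_eq_0D[of n d r] less.prems by (simp add: d_def)
qed

text \<open>The residual of \<open>x\<close> is orthogonal to the orthogonalized family, hence to
  every \<open>v k\<close> with \<open>k < m\<close> and to \<open>x\<close> in their span. So it is
  orthogonal to itself and vanishes.\<close>

lemma orthogonalize_expansion:
  assumes span: "\<And>r. r < n \<Longrightarrow> x r = (\<Sum>k<m. y k * v k r)" and "r < n"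
  shows "x r = (\<Sum>k<m. cinner n x (orthogonalize n v k) / cinner n (orthogonalize n v k) (orthogonalize n v k) * orthogonalize n v k r)"
proof -
  let ?f = "residual n (orthogonalize n v) m x"
  have orth: "cinner n ?f (orthogonalize n v i) = 0" if "i < m" for i
    by (rule residual_orthogonal) (auto simp: that orthogonalize_orthogonal)
  have "cinner n ?f x = cinner n ?f (\<lambda>r. \<Sum>k<m. y k * v k r)"
    using span by (intro cinner_cong) auto
  also have "\<dots> = 0"
    by (simp add: cinner_linear orthogonal_orthogonalize_imp_orthogonal[OF orth])
  finally have "cinner n ?f ?f = 0"
    \<comment> \<open>Only the right argument is unfolded, so that \<open>orth\<close> still matches
      the left one.\<close>
    by (subst (2) residual_def) 
      (simp add: cinner_linear orth del: times_divide_eq_left)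
  from cinner_self_eq_0D[OF this \<open>r < n\<close>] show ?thesis
    by (simp add: residual_def)
qed

section \<open>Triangularization with the eigenvalues in the given order\<close>

lemma schur_triangularization:
  fixes A :: "complex mat"
  assumes A: "A \<in> carrier_mat n n" and cp: "char_poly A = (\<Prod>i<n. [:- l i, 1:])"
  obtains T P Q where "similar_mat_wit A T P Q" "upper_triangular T"
    "\<And>i. i < n \<Longrightarrow> T $$ (i, i) = l i"
proof -
  obtain T P Q where schur: "schur_decomposition A (map l [0..<n]) = (T, P, Q)"
    by (metis prod_cases3)
  have "char_poly A = (\<Prod>e\<leftarrow>map l [0..<n]. [:- e, 1:])"
    unfolding cp by (simp add: prod.list_conv_set_nth atLeast0LessThan)
  from schur_decomposition[OF A this schur] 
  have wit: "similar_mat_wit A T P Q" and T: "upper_triangular T" and diag: "diag_mat T = map l [0..<n]"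
    by auto
  have "T $$ (i, i) = l i" if "i < n" for i
    using arg_cong[OF diag, of "\<lambda>xs. xs ! i"] that similar_mat_witD2[OF A wit] 
    by (simp add: diag_mat_def)
  with wit T show thesis by (rule that)
qed

lemma sum_diagonal_mult_commute:
  fixes A B :: "'a :: comm_semiring_0 mat"
  assumes "A \<in> carrier_mat n m" "B \<in> carrier_mat m n"
  shows "(\<Sum>i<n. (A * B) $$ (i, i)) = (\<Sum>i<m. (B * A) $$ (i, i))"
  using assms by (simp add: scalar_prod_def atLeast0LessThan, subst sum.swap) (simp add: mult.commute)

text \<open>In an orthogonal eigenbasis both forms are diagonal, with the same weights:
  \<open>w k\<close> is the squared length of the component of \<open>x\<close> along the
  \<open>k\<close>-th basis vector.\<close>

lemma normal_numerical_range:
  fixes A :: "complex mat" and x :: "nat \<Rightarrow> complex"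
  assumes A: "A \<in> carrier_mat n n" and "normal_mat A"
    and cp: "char_poly A = (\<Prod>i<n. [:- l i, 1:])"
  obtains w :: "nat \<Rightarrow> real" where "\<And>k. w k \<ge> 0"
    "cinner n x x = of_real (\<Sum>k<n. w k)"
    "cinner n (mapply n (\<lambda>i j. A $$ (i, j)) x) x = (\<Sum>k<n. l k * of_real (w k))"
proof -
  let ?a = "\<lambda>i j. A $$ (i, j)"
  obtain T P Q where wit: "similar_mat_wit A T P Q" and T: "upper_triangular T" 
    and diagT: "\<And>i. i < n \<Longrightarrow> T $$ (i, i) = l i"
    using schur_triangularization[OF A cp] by metis
  note sim = similar_mat_witD2[OF A wit]
  define v where "v = (\<lambda>j r. P $$ (r, j))"
  define u where "u = orthogonalize n v"
  have normal: "(\<Sum>k<n. ?a i k * adj ?a k j) = (\<Sum>k<n. adj ?a i k * ?a k j)" if "i < n" "j < n" for i j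
  proof -
    have "(A * mat_adjoint A) $$ (i, j) = (mat_adjoint A * A) $$ (i, j)"
      using \<open>normal_mat A\<close> by (simp add: normal_mat_def)
    then show ?thesis
      using that A by (simp add: mat_adjoint_def scalar_prod_def adj_def atLeast0LessThan mat_of_rows_def)
  qed
  have "A * P = P * T * Q * P"
    using sim(3) by simp
  also have "\<dots> = P * T * (Q * P)"
    using sim(5-7) by (intro assoc_mult_mat) auto
  finally have "A * P = P * T"
    using sim(2,5-7) by simp
  have triangular: "mapply n ?a (v j) r = l j * v j r + (\<Sum>m<j. T $$ (m, j) * v m r)" if "j < n" "r < n" for j r
  proof -
    have "mapply n ?a (v j) r = (A * P) $$ (r, j)"
      using that A sim(6) by (simp add: mapply_def v_def scalar_prod_def atLeast0LessThan)
    also have "\<dots> = (\<Sum>m<n. T $$ (m, j) * v m r)"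
      unfolding \<open>A * P = P * T\<close> using that sim(5,6) 
      by (simp add: v_def scalar_prod_def atLeast0LessThan mult.commute)
    also have "\<dots> = (\<Sum>m<Suc j. T $$ (m, j) * v m r)"
      using that T sim(5) by (intro sum.mono_neutral_right) auto
    finally show ?thesis
      using that diagT by simp
  qed
  have eig: "mapply n ?a (u k) r = l k * u k r" if "k < n" "r < n" for k r
    unfolding u_def by (rule normal_orthogonalize_eigenvector[OF normal triangular]) (use that in auto)
  define c where "c = (\<lambda>k. cinner n x (u k) / cinner n (u k) (u k))"
  \<comment> \<open>The coordinates of \<open>x\<close> in the columns of \<open>P\<close>, whose
    inverse is \<open>Q\<close>.\<close>
  define y where "y = (\<lambda>k. \<Sum>i<n. Q $$ (k, i) * x i)"
  have span: "x r = (\<Sum>k<n. y k * v k r)" if "r < n" for r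
  proof -
    have "(\<Sum>k<n. y k * v k r) = (\<Sum>i<n. (\<Sum>k<n. P $$ (r, k) * Q $$ (k, i)) * x i)"
      unfolding y_def v_def by (simp add: sum_distrib_right, subst sum.swap) (simp add: algebra_simps)
    also have "\<dots> = (\<Sum>i<n. (P * Q) $$ (r, i) * x i)"
      using that sim(6,7) by (intro sum.cong) (simp_all add: scalar_prod_def atLeast0LessThan)
    also have "\<dots> = (\<Sum>i<n. if i = r then x i else 0)"
      using that sim(1) by (intro sum.cong) auto
    finally show ?thesis using that by simp
  qed
  have x: "x r = (\<Sum>k<n. c k * u k r)" if "r < n" for r
    unfolding c_def u_def using span that by (rule orthogonalize_expansion)
  have ax: "mapply n ?a x r = (\<Sum>k<n. c k * l k * u k r)" if "r < n" for r
  proof -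
    have "mapply n ?a x r = mapply n ?a (\<lambda>r. \<Sum>k<n. c k * u k r) r"
      using x by (simp cong: mapply_cong)
    also have "\<dots> = (\<Sum>k<n. c k * mapply n ?a (u k) r)"
      by (rule mapply_sum_scale)
    finally show ?thesis using that by (simp add: eig mult.assoc)
  qed
  \<comment> \<open>Defined as a real number, so that its sign is evident; the fact \<open>w\<close>
    below matches it with the complex term that occurs in both forms.\<close>
  define w where "w = (\<lambda>k. (cmod (c k))\<^sup>2 * (\<Sum>r<n. (cmod (u k r))\<^sup>2))"
  have ux: "cinner n (u k) x = cnj (c k) * cinner n (u k) (u k)" if "k < n" for k
  proof -
    have "cinner n (u k) x = (\<Sum>i<n. cnj (c i) * cinner n (u k) (u i))"
      using cinner_cong[of n "u k" "u k" x "\<lambda>r. \<Sum>k<n. c k * u k r"] x by (simp add: cinner_linear)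
    also have "\<dots> = (\<Sum>i<n. if i = k then cnj (c k) * cinner n (u k) (u k) else 0)"
      by (intro sum.cong) (auto simp: u_def orthogonalize_orthogonal)
    finally show ?thesis using that by simp
  qed
  have w: "c k * cinner n (u k) x = of_real (w k)" if "k < n" for k
    unfolding ux[OF that] w_def cinner_self of_real_mult complex_norm_square 
    by (simp only: mult.assoc)
  show ?thesis
  proof
    show "w k \<ge> 0" for k by (simp add: w_def sum_nonneg)
    have "cinner n x x = (\<Sum>k<n. c k * cinner n (u k) x)"
      using cinner_cong[of n x "\<lambda>r. \<Sum>k<n. c k * u k r" x x] x by (simp add: cinner_linear)
    then show "cinner n x x = of_real (\<Sum>k<n. w k)"
      by (simp add: w)
    have "cinner n (mapply n ?a x) x = (\<Sum>k<n. l k * (c k * cinner n (u k) x))"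
      using cinner_cong[of n "mapply n ?a x" "\<lambda>r. \<Sum>k<n. c k * l k * u k r" x x] ax
      by (simp add: cinner_linear mult_ac)
    then show "cinner n (mapply n ?a x) x = (\<Sum>k<n. l k * of_real (w k))"
      by (simp add: w)
  qed
qed

text \<open>The trace is invariant under similarity, and \<open>T\<close> carries the eigenvalues on
  its diagonal.\<close>

lemma sum_diagonal_eq_sum_eigenvalues:
  fixes A :: "complex mat"
  assumes A: "A \<in> carrier_mat n n" and cp: "char_poly A = (\<Prod>i<n. [:- l i, 1:])"
  shows "(\<Sum>i<n. A $$ (i, i)) = (\<Sum>i<n. l i)"
proof -
  obtain T P Q where wit: "similar_mat_wit A T P Q" and diag: "\<And>i. i < n \<Longrightarrow> T $$ (i, i) = l i"
    using schur_triangularization[OF A cp] by metis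
  note sim = similar_mat_witD2[OF A wit]
  have "(\<Sum>i<n. A $$ (i, i)) = (\<Sum>i<n. (P * T * Q) $$ (i, i))"
    using sim(3) by simp
  also have "\<dots> = (\<Sum>i<n. (Q * (P * T)) $$ (i, i))"
    using sim(5-7) by (intro sum_diagonal_mult_commute) auto
  also have "Q * (P * T) = Q * P * T"
    using sim(5-7) by (intro assoc_mult_mat[symmetric]) auto
  also have "\<dots> = T"
    using sim(2,5) by simp
  finally show ?thesis by (simp add: diag)
qed

theorem theorem3p2:
  fixes n :: nat and A :: "complex mat" and l :: "nat \<Rightarrow> complex"
  assumes "n \<ge> 2"
    and "A \<in> carrier_mat n n"
    and "normal_mat A"
    and "char_poly A = (\<Prod>i<n. [:- l i, 1:])"
  shows "spd A \<ge> (MAX (i, j) \<in> {..<n} \<times> {..<n}.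
            cmod (l i - 1 / (of_nat n - 1) * (\<Sum>k\<in>{..<n} - {j}. l k)))
       \<and> (MAX (i, j) \<in> {..<n} \<times> {..<n}.
            cmod (l i - 1 / (of_nat n - 1) * (\<Sum>k\<in>{..<n} - {j}. l k)))
          \<ge> 1 / (real n - 1) *
            cmod (\<Sum>(i, j) \<in> {(i, j). i < n \<and> j < n \<and> i \<noteq> j}. A $$ (i, j))"
proof (rule conjI)
  let ?f = "\<lambda>i j. cmod (l i - 1 / (of_nat n - 1) * (\<Sum>k\<in>{..<n} - {j}. l k))"
  let ?I = "{..<n} \<times> {..<n}"
  let ?M = "MAX (i, j) \<in> ?I. ?f i j"
  have ne: "?I \<noteq> {}"
    using \<open>n \<ge> 2\<close> by (auto simp: lessThan_empty_iff)
  have n1: "real n - 1 > 0" "complex_of_nat n - 1 = of_real (real n - 1)"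
    using \<open>n \<ge> 2\<close> by auto

  \<comment> \<open>Clears the denominator \<open>n - 1\<close>, for both inequalities.\<close>
  have scale: "(real n - 1) * cmod (z - 1 / (of_nat n - 1) * S) = cmod ((of_nat n - 1) * z - S)" for z S
  proof -
    have "(of_nat n - 1) * z - S = of_real (real n - 1) * (z - 1 / (of_nat n - 1) * S)"
      using n1 by (simp add: right_diff_distrib)
    then show ?thesis
      using n1 by (simp only: norm_mult norm_of_real)
  qed

  show "?M \<le> spd A"
  proof (rule Max.boundedI)
    show "finite ((\<lambda>(i, j). ?f i j) ` ?I)" by simp
    show "(\<lambda>(i, j). ?f i j) ` ?I \<noteq> {}" using ne by simp
    fix m assume "m \<in> (\<lambda>(i, j). ?f i j) ` ?I"
    then obtain i j where "i < n" "j < n" and m: "m = ?f i j" by auto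
    have le: "cmod (l i - l k) \<le> spd A" if "k < n" for k
      unfolding spd_eq_Max_index[OF assms(2,4)] using that \<open>i < n\<close> by (intro Max_ge) auto
    have card: "card ({..<n} - {j}) = n - 1" using \<open>j < n\<close> by simp
    \<comment> \<open>There are \<open>n - 1\<close> indices \<open>k\<close> other than
      \<open>j\<close>, so one copy of \<open>l i\<close> goes to each \<open>l k\<close>.\<close>
    have "(of_nat n - 1) * l i - (\<Sum>k\<in>{..<n} - {j}. l k) = (\<Sum>k\<in>{..<n} - {j}. l i - l k)"
      using \<open>n \<ge> 2\<close> card by (simp add: sum_subtractf of_nat_diff)
    then have "(real n - 1) * m = cmod (\<Sum>k\<in>{..<n} - {j}. l i - l k)"
      unfolding m by (simp only: scale)
    also have "\<dots> \<le> (\<Sum>k\<in>{..<n} - {j}. cmod (l i - l k))"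
      by (rule norm_sum)
    also have "\<dots> \<le> (\<Sum>k\<in>{..<n} - {j}. spd A)"
      by (intro sum_mono le) auto
    also have "\<dots> = (real n - 1) * spd A"
      using \<open>n \<ge> 2\<close> card by (simp add: of_nat_diff)
    finally show "m \<le> spd A"
      using n1 by simp
  qed

  \<comment> \<open>For the all-ones vector the form is the sum of all entries of
    \<open>A\<close>.\<close>
  obtain w :: "nat \<Rightarrow> real" where w0: "\<And>k. w k \<ge> 0"
    and w1: "cinner n (\<lambda>_. 1) (\<lambda>_. 1) = of_real (\<Sum>k<n. w k)"
    and wl: "cinner n (mapply n (\<lambda>i j. A $$ (i, j)) (\<lambda>_. 1)) (\<lambda>_. 1) = (\<Sum>k<n. l k * of_real (w k))"
    by (rule normal_numerical_range[OF assms(2-4), of "\<lambda>_. 1"]) (rule that)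
  define L where "L = (\<Sum>k<n. l k)"
  have sumw: "(\<Sum>k<n. w k) = real n"
  proof -
    have "complex_of_real (\<Sum>k<n. w k) = of_real (real n)"
      unfolding w1[symmetric] by (simp add: cinner_def)
    then show ?thesis by (simp only: of_real_eq_iff)
  qed
  have "{(i, j). i < n \<and> j < n \<and> i \<noteq> j} = (SIGMA i:{..<n}. {..<n} - {i})" by auto
  then have "(\<Sum>(i, j) \<in> {(i, j). i < n \<and> j < n \<and> i \<noteq> j}. A $$ (i, j))
    = (\<Sum>i<n. (\<Sum>j\<in>{..<n} - {i}. A $$ (i, j)))"
    by (simp add: sum.Sigma)
  also have "\<dots> = (\<Sum>i<n. (\<Sum>j<n. A $$ (i, j)) - A $$ (i, i))"
    by (intro sum.cong refl) (simp add: sum_diff1)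
  also have "\<dots> = (\<Sum>k<n. l k * of_real (w k)) - L"
    unfolding wl[symmetric] L_def sum_diagonal_eq_sum_eigenvalues[OF assms(2,4), symmetric]
    by (simp add: sum_subtractf cinner_def mapply_def)
  finally have off: "(\<Sum>(i, j) \<in> {(i, j). i < n \<and> j < n \<and> i \<noteq> j}. A $$ (i, j))
    = (\<Sum>k<n. l k * of_real (w k)) - L" .
  \<comment> \<open>The weights have total \<open>n\<close>, so after multiplication by
    \<open>n\<close> the subtracted trace \<open>L\<close> can be spread over them.\<close>
  have "(\<Sum>k<n. of_real (w k) * (of_nat n * l k - L)) 
    = of_nat n * (\<Sum>k<n. l k * of_real (w k)) - of_real (\<Sum>k<n. w k) * L"
    by (simp add: algebra_simps sum_subtractf sum_distrib_left)
  then have off_n: "of_nat n * (\<Sum>(i, j) \<in> {(i, j). i < n \<and> j < n \<and> i \<noteq> j}. A $$ (i, j)) 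
    = (\<Sum>k<n. of_real (w k) * (of_nat n * l k - L))"
    unfolding off sumw by (simp add: algebra_simps)
  \<comment> \<open>The pair \<open>i = j = k\<close> of the maximum:
    \<open>(n - 1) l k - (L - l k) = n l k - L\<close>.\<close>
  have le: "cmod (of_nat n * l k - L) \<le> (real n - 1) * ?M" if "k < n" for k
  proof -
    have "?f k k \<le> ?M"
      using that by (intro Max_ge) auto
    moreover have "(real n - 1) * ?f k k = cmod (of_nat n * l k - L)"
      unfolding scale using that by (simp add: L_def sum_diff1 algebra_simps)
    ultimately show ?thesis
      using n1 by (metis mult_left_mono less_imp_le)
  qed
  have "real n * cmod (\<Sum>(i, j) \<in> {(i, j). i < n \<and> j < n \<and> i \<noteq> j}. A $$ (i, j))
    = cmod (\<Sum>k<n. of_real (w k) * (of_nat n * l k - L))"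
    unfolding off_n[symmetric] by (simp add: norm_mult)
  also have "\<dots> \<le> (\<Sum>k<n. w k * cmod (of_nat n * l k - L))"
    by (rule order_trans[OF norm_sum]) (simp add: norm_mult w0)
  also have "\<dots> \<le> (\<Sum>k<n. w k * ((real n - 1) * ?M))"
    using le w0 by (intro sum_mono mult_left_mono) auto
  also have "\<dots> = real n * ((real n - 1) * ?M)"
    by (simp only: sum_distrib_right[symmetric] sumw)
  finally have "cmod (\<Sum>(i, j) \<in> {(i, j). i < n \<and> j < n \<and> i \<noteq> j}. A $$ (i, j)) \<le> (real n - 1) * ?M"
    by (rule mult_left_le_imp_le) (use \<open>n \<ge> 2\<close> in simp)
  then have "cmod (\<Sum>(i, j) \<in> {(i, j). i < n \<and> j < n \<and> i \<noteq> j}. A $$ (i, j)) / (real n - 1) \<le> ?M"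
    by (simp only: pos_divide_le_eq[OF n1(1)] mult.commute)
  then show "1 / (real n - 1) *
            cmod (\<Sum>(i, j) \<in> {(i, j). i < n \<and> j < n \<and> i \<noteq> j}. A $$ (i, j)) \<le> ?M"
    by (simp only: times_divide_eq_left mult_1)
qed

end
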